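(* The common terms of the Fibonacci and Lucas numbers with positive indices are exactly $1$ and $3$; that is, $$\{F_k : k \geqslant 1\} \cap \{L_n : n \geqslant 1\} = \{1, 3\}.$$
   Context: $(F_n)_{n\geqslant 0}$ is the Fibonacci sequence: $F_0=0$, $F_1=1$, $F_{n+1}=F_n+F_{n-1}$ for $n \geqslant 1$. $(L_n)_{n\geqslant 0}$ is the Lucas sequence: $L_0=2$, $L_1=1$, $L_{n+1}=L_n+L_{n-1}$ for $n\geqslant 1$. Only terms with positive indices are considered. *)

theory Defs
  imports "HOL-Number_Theory.Fib"
begin

fun lucas :: "nat \<Rightarrow> nat" where
  "lucas 0 = 2"
| "lucas (Suc 0) = 1"
| "lucas (Suc (Suc n)) = lucas (Suc n) + lucas n"

end

(* For n \<ge> 3 the identity L_n = F_(n-1) + F_(n+1) places L_n strictly between the consecutive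
   Fibonacci numbers F_(n+1) and F_(n+2), so only L_1 and L_2 can be Fibonacci numbers. *)
theory Submission
  imports Defs
begin

text \<open>Since \<open>fib\<close> is monotone, a number strictly between two consecutive values
  is never a value. \<open>lucas_between_fib\<close> traps L_n in such a gap for n \<ge> 3, so
  \<open>lucas_neq_fib\<close> leaves only L_1 = 1 and L_2 = 3.\<close>

lemma lucas_Suc_eq_fib: "lucas (Suc n) = fib n + fib (Suc (Suc n))"
  by (induction n rule: fib.induct) auto

lemma lucas_between_fib:
  assumes "n \<ge> 3"
  shows "fib (n + 1) < lucas n" "lucas n < fib (n + 2)"
proof -
  obtain m where n: "n = Suc (Suc (Suc m))"
    using assms by (metis Suc_diff_le Suc_le_D numeral_3_eq_3 Suc_le_mono)
  \<comment> \<open>This is F_(n-2) = F_(n+2) - L_n, the margin in the upper bound. It vanishes at n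
    = 2, where L_2 = F_4. The lower margin is L_n - F_(n+1) = F_(n-1).\<close>
  have "fib (Suc m) > 0"
    by (simp add: fib_neq_0_nat)
  then show "fib (n + 1) < lucas n" "lucas n < fib (n + 2)"
    by (simp_all add: n lucas_Suc_eq_fib del: lucas.simps)
qed

lemma lucas_neq_fib:
  assumes "n \<ge> 3"
  shows "lucas n \<noteq> fib k"
proof (cases "k \<le> n + 1")
  case True
  then show ?thesis
    using fib_mono[OF True] lucas_between_fib(1)[OF assms] by simp
next
  case False
  then have "n + 2 \<le> k" by simp
  then show ?thesis
    using fib_mono[of "n + 2" k] lucas_between_fib(2)[OF assms] by simp
qed

theorem corollary1:
  shows "{fib k | k. k \<ge> 1} \<inter> {lucas n | n. n \<ge> 1} = {1, 3}"
proof (intro equalityI subsetI)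
  fix x assume "x \<in> {fib k | k. k \<ge> 1} \<inter> {lucas n | n. n \<ge> 1}"
  then obtain k n where x: "x = fib k" "x = lucas n" and "n \<ge> 1"
    by blast
  then have "n = 1 \<or> n = 2"
    using lucas_neq_fib[of n k] by linarith
  then show "x \<in> {1, 3}"
    using x(2) by (auto simp: numeral_2_eq_2)
next
  fix x :: nat assume "x \<in> {1, 3}"
  \<comment> \<open>Witnesses with positive indices: 1 = F_1 = L_1 and 3 = F_4 = L_2.\<close>
  moreover have "fib 1 = 1" "lucas 1 = 1" "fib 4 = 3" "lucas 2 = 3"
    by (simp_all add: eval_nat_numeral)
  moreover have "(1::nat) \<le> 4" "(1::nat) \<le> 2"
    by simp_all
  ultimately show "x \<in> {fib k | k. k \<ge> 1} \<inter> {lucas n | n. n \<ge> 1}"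
    by (smt (verit) IntI insertE mem_Collect_eq order_refl singletonD)
qed

end
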